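(* Any $d$-regular graph with order at least $d^3-2d^2+2d+2$ is meagre.
   Context: All graphs are simple, connected and finite. A set $S$ of vertices of a graph $H$ is a general position set if no shortest path in $H$ contains three or more vertices of $S$; $\mathrm{gp}(H)$ is the number of vertices in a largest general position set of $H$. The Mycielskian $\mathcal{M}(G)$ of a graph $G$ with vertex set $V$ and edge set $E$ has vertex set $V\cup V'\cup\{u^*\}$, where $V'=\{u' : u\in V\}$ is a disjoint copy of $V$ and $u^*$ is an additional vertex (the root), and edge set $E\cup\{uv' : uv\in E\}\cup\{v'u^* : v'\in V'\}$ (for each edge $uv\in E$ both $uv'$ and $vu'$ are included). An independent $4$-position set of $G$ is a subset $S\subseteq V(G)$ that is an independent set and such that no shortest path of $G$ of length at most $4$ passes through three or more vertices of $S$; $\mathrm{ip}_4(G)$ is the largest number of vertices in such a set. A non-complete graph $G$ with order $n\geq 3$ is meagre if $\mathrm{gp}(\mathcal{M}(G))=\max\{n,2\,\mathrm{ip}_4(G)\}$. *)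

theory Defs
  imports "Graph_Theory.Graph_Theory"
begin

text \<open>
  A finite simple graph is represented as a finite, symmetric, loop-free digraph without
  parallel arcs (\<^locale>\<open>pair_graph\<close>): an edge \<open>uv\<close> corresponds to the two arcs \<open>(u, v)\<close> and
  \<open>(v, u)\<close>, so the degree of a vertex is its out-degree.
\<close>

definition regular :: "nat \<Rightarrow> 'a pair_pre_digraph \<Rightarrow> bool" where
  "regular d G \<longleftrightarrow> (\<forall>v \<in> pverts G. out_degree G v = d)"

definition shortest_path :: "'a pair_pre_digraph \<Rightarrow> 'a vwalk \<Rightarrow> bool" where
  "shortest_path G p \<longleftrightarrow> vpath p G \<and>
     (\<forall>q. vpath q G \<and> hd q = hd p \<and> last q = last p \<longrightarrow> vwalk_length p \<le> vwalk_length q)"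

definition general_position_set :: "'a pair_pre_digraph \<Rightarrow> 'a set \<Rightarrow> bool" where
  "general_position_set G S \<longleftrightarrow> S \<subseteq> pverts G \<and>
     (\<forall>p. shortest_path G p \<longrightarrow> \<not> card (S \<inter> set p) \<ge> 3)"

definition gp :: "'a pair_pre_digraph \<Rightarrow> nat" where
  "gp G = Max {card S | S. general_position_set G S}"

definition independent_set :: "'a pair_pre_digraph \<Rightarrow> 'a set \<Rightarrow> bool" where
  "independent_set G S \<longleftrightarrow> S \<subseteq> pverts G \<and> (\<forall>u \<in> S. \<forall>v \<in> S. (u, v) \<notin> parcs G)"

definition independent_position_set :: "nat \<Rightarrow> 'a pair_pre_digraph \<Rightarrow> 'a set \<Rightarrow> bool" where
  "independent_position_set k G S \<longleftrightarrow> independent_set G S \<and>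
     (\<forall>p. shortest_path G p \<and> vwalk_length p \<le> k \<longrightarrow> \<not> card (S \<inter> set p) \<ge> 3)"

definition ip :: "nat \<Rightarrow> 'a pair_pre_digraph \<Rightarrow> nat" where
  "ip k G = Max {card S | S. independent_position_set k G S}"

datatype 'a mycielski_vertex = Orig 'a | Twin 'a | Root

definition mycielskian :: "'a pair_pre_digraph \<Rightarrow> 'a mycielski_vertex pair_pre_digraph" where
  "mycielskian G = \<lparr>
     pverts = Orig ` pverts G \<union> Twin ` pverts G \<union> {Root},
     parcs = {(Orig u, Orig v) | u v. (u, v) \<in> parcs G}
       \<union> {(Orig u, Twin v) | u v. (u, v) \<in> parcs G}
       \<union> {(Twin v, Orig u) | u v. (u, v) \<in> parcs G}
       \<union> {(Twin v, Root) | v. v \<in> pverts G}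
       \<union> {(Root, Twin v) | v. v \<in> pverts G} \<rparr>"

lemma pair_graph_mycielskian:
  assumes "pair_graph G"
  shows "pair_graph (mycielskian G)"
proof -
  interpret pair_graph G by fact
  have sym: "(v, u) \<in> parcs G" if "(u, v) \<in> parcs G" for u v
    using that by (rule arcs_symmetric)
  have wf: "u \<in> pverts G" "v \<in> pverts G" if "(u, v) \<in> parcs G" for u v
    using that by (auto dest: in_arcsD1 in_arcsD2)
  have V: "finite (pverts (mycielskian G))"
    using pair_finite_verts by (simp add: mycielskian_def)
  have A: "parcs (mycielskian G) \<subseteq> pverts (mycielskian G) \<times> pverts (mycielskian G)"
    by (auto simp: mycielskian_def dest: wf)
  have "finite (parcs (mycielskian G))"
    using A V by (meson finite_SigmaI finite_subset)
  moreover have "symmetric (with_proj (mycielskian G))"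
    by (auto simp: symmetric_def mycielskian_def sym intro!: symI)
  moreover have "fst e \<noteq> snd e" if "e \<in> parcs (mycielskian G)" for e
    using that pair_no_loops by (auto simp: mycielskian_def)
  ultimately show ?thesis
    using V A by unfold_locales auto
qed

definition meagre :: "'a pair_pre_digraph \<Rightarrow> bool" where
  "meagre G \<longleftrightarrow> pair_graph G \<and> Digraph_Component.connected G \<and>
     \<not> complete_digraph (card (pverts G)) G \<and> card (pverts G) \<ge> 3 \<and>
     gp (mycielskian G) = max (card (pverts G)) (2 * ip 4 G)"

end

theory Submission
  imports Defs
begin

text \<open>
  For a \<open>d\<close>-regular graph on \<open>n\<close> vertices both terms of the maximum are easy to compare: counting
  the edges between an independent set and its complement shows that the set has at most \<open>n / 2\<close>
  vertices, so \<open>2 ip\<^sub>4 \<le> n\<close>. The twins form a general position set of the Mycielskian, because any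
  two of them are joined by a path of length two through the root. It remains to show that a
  general position set \<open>S\<close> of the Mycielskian has at most \<open>n\<close> vertices
  (\<open>card_le_order\<close>).

  Suppose first that the root is not in \<open>S\<close>. Call a vertex \<open>u\<close> of \<open>G\<close> a pair if both \<open>u\<close> and its
  twin \<open>u'\<close> are in \<open>S\<close>, and missing if neither is. Then \<open>|S|\<close> is \<open>n\<close> plus the number of pairs
  minus the number of missing vertices, so there must not be more pairs than missing vertices.
  A neighbour \<open>w\<close> of a pair \<open>u\<close> is not in \<open>S\<close> (it would lie on a geodesic from \<open>u\<close> to \<open>u'\<close>), and
  the twin of at most one neighbour is in \<open>S\<close> (two such twins have a geodesic through \<open>u\<close>). If no
  neighbour of a pair has its twin in \<open>S\<close>, all neighbours of pairs are missing, and regularity gives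
  the claim by counting edges.

  Otherwise there are a pair \<open>u\<close> and a neighbour \<open>w\<close> of \<open>u\<close> with \<open>w'\<close> in \<open>S\<close>. The geodesics that
  start with \<open>u, w'\<close> then force everything that is not missing to be close to \<open>u\<close>: a twin in
  \<open>S\<close> belongs to a vertex within distance two of \<open>u\<close>, and a vertex of \<open>G\<close> in \<open>S\<close> has distance at
  most three from \<open>u\<close>, and distance three only if no shortest path to it passes through \<open>w\<close>.
  With \<open>e = d - 1\<close> this leaves room for at most \<open>2 + e + e\<^sup>2 + e\<^sup>3\<close> vertices, which is the given lower
  bound on \<open>n\<close> minus one. If there were more pairs than missing vertices, then

    \<^item> either all pairs are neighbours of \<open>w\<close>, and the counts are so tight that \<open>G\<close> is the complete
      bipartite graph \<open>K\<^bsub>d,d\<^esub>\<close>, which is too small (\<open>card_pairs_le_if_pairs_around_twin\<close>);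

    \<^item> or some pair is not a neighbour of \<open>w\<close>. Each such pair closes off \<open>e\<close> places at distance three
      from \<open>u\<close>, because the neighbours of a pair are not in \<open>S\<close>, and the existence of one of them
      makes a neighbour of \<open>w\<close> fail to be a pair. These losses outweigh the missing vertices, so
      that \<open>n \<le> 2 + e + e\<^sup>2 + e\<^sup>3\<close> after all (\<open>card_pairs_le_card_missing\<close>).

  If the root is in \<open>S\<close>, at most one twin is, and one twin \<open>w'\<close> excludes all \<open>d \<ge> 2\<close> neighbours of
  \<open>w\<close>; without twins, \<open>S\<close> cannot contain every vertex of \<open>G\<close>, as \<open>G\<close> is not complete.
\<close>

section \<open>Short geodesics\<close>

lemma shortest_pathI:
  assumes "vpath p (with_proj H)"
    and "\<And>q. vpath q (with_proj H) \<Longrightarrow> hd q = hd p \<Longrightarrow> last q = last p \<Longrightarrow> q \<noteq> [] \<Longrightarrow>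
      length q < length p \<Longrightarrow> False"
  shows "shortest_path H p"
  unfolding shortest_path_def
proof (intro conjI allI impI)
  fix q assume q: "vpath q (with_proj H) \<and> hd q = hd p \<and> last q = last p"
  then have "q \<noteq> []" by (auto simp: vpath_def vwalk_def)
  then have "length p \<le> length q" using assms(2)[of q] q by force
  then show "vwalk_length p \<le> vwalk_length q" by simp
qed fact

text \<open>
  Up to length four, the shortness of a walk between distinct ends can be read off from the absence
  of the shorter walks between them; distinctness of the inner vertices then comes for free.
\<close>

lemma shortest_path_two:
  assumes "pair_graph H" "(a, b) \<in> parcs H" "(b, c) \<in> parcs H"
    and "a \<noteq> c" "(a, c) \<notin> parcs H"
  shows "shortest_path H [a, b, c]"
proof (rule shortest_pathI)
  interpret pair_graph H by fact
  show "vpath [a, b, c] (with_proj H)"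
    using assms pair_no_loops by (auto simp: vpath_def vwalk_def dest: in_arcsD1 in_arcsD2)
next
  fix q assume q: "vpath q (with_proj H)" "hd q = hd [a, b, c]" "last q = last [a, b, c]"
    and "q \<noteq> []" "length q < length [a, b, c]"
  then consider x where "q = [x]" | x y where "q = [x, y]"
    by (cases q; cases "tl q"; cases "tl (tl q)"; cases "tl (tl (tl q))") auto
  then show False using q assms by cases (auto simp: vpath_def vwalk_def)
qed

lemma shortest_path_three:
  assumes "pair_graph H" "(a, b) \<in> parcs H" "(b, c) \<in> parcs H" "(c, e) \<in> parcs H"
    and "a \<noteq> e" "(a, e) \<notin> parcs H" "\<And>x. (a, x) \<in> parcs H \<Longrightarrow> (x, e) \<notin> parcs H"
  shows "shortest_path H [a, b, c, e]"
proof (rule shortest_pathI)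
  interpret pair_graph H by fact
  show "vpath [a, b, c, e] (with_proj H)"
    using assms pair_no_loops by (auto simp: vpath_def vwalk_def dest: in_arcsD1 in_arcsD2)
next
  fix q assume q: "vpath q (with_proj H)" "hd q = hd [a, b, c, e]" "last q = last [a, b, c, e]"
    and "q \<noteq> []" "length q < length [a, b, c, e]"
  then consider x where "q = [x]" | x y where "q = [x, y]" | x y z where "q = [x, y, z]"
    by (cases q; cases "tl q"; cases "tl (tl q)"; cases "tl (tl (tl q))") auto
  then show False using q assms by cases (auto simp: vpath_def vwalk_def)
qed

lemma shortest_path_four:
  assumes "pair_graph H"
    and "(a, b) \<in> parcs H" "(b, c) \<in> parcs H" "(c, e) \<in> parcs H" "(e, f) \<in> parcs H"
    and "a \<noteq> f" "(a, f) \<notin> parcs H" "\<And>x. (a, x) \<in> parcs H \<Longrightarrow> (x, f) \<notin> parcs H"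
    and "\<And>x y. (a, x) \<in> parcs H \<Longrightarrow> (x, y) \<in> parcs H \<Longrightarrow> (y, f) \<notin> parcs H"
  shows "shortest_path H [a, b, c, e, f]"
proof (rule shortest_pathI)
  interpret pair_graph H by fact
  show "vpath [a, b, c, e, f] (with_proj H)"
    using assms pair_no_loops by (auto simp: vpath_def vwalk_def dest: in_arcsD1 in_arcsD2)
next
  fix q assume q: "vpath q (with_proj H)" "hd q = hd [a, b, c, e, f]" "last q = last [a, b, c, e, f]"
    and "q \<noteq> []" "length q < length [a, b, c, e, f]"
  then consider x where "q = [x]" | x y where "q = [x, y]" | x y z where "q = [x, y, z]"
    | x y z t where "q = [x, y, z, t]"
    by (cases q; cases "tl q"; cases "tl (tl q)"; cases "tl (tl (tl q))") auto
  then show False using q assms by cases (auto simp: vpath_def vwalk_def)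
qed

lemma length_vwalk_to_vpath_le: "length (vwalk_to_vpath p) \<le> length p"
proof (induction p rule: vwalk_to_vpath.induct)
  case (2 x xs)
  then show ?case using length_dropWhile_le[of "\<lambda>y. y \<noteq> x" xs] by force
qed simp

text \<open>
  Walks may repeat vertices, so a detour can be compared with a shortest path without checking that
  it avoids the rest of that path.
\<close>

lemma shortest_path_le_vwalk:
  assumes "shortest_path H p" "vwalk q (with_proj H)" "hd q = hd p" "last q = last p"
  shows "length p \<le> length q"
proof -
  have "vpath (vwalk_to_vpath q) (with_proj H)"
    using assms(2) by (rule vwalk_to_vpath_vpath)
  then have "length p - 1 \<le> length (vwalk_to_vpath q) - 1"
    using assms unfolding shortest_path_def
    by (auto simp: vwalk_to_vpath_hd vwalk_to_vpath_last)
  moreover have "q \<noteq> []" using assms by (auto simp: vwalk_def)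
  then have "0 < length (vwalk_to_vpath q)" by (simp add: vwalk_to_vpath_nonempty)
  ultimately show ?thesis using length_vwalk_to_vpath_le[of q] by linarith
qed

lemma general_position_no_three_on_geodesic:
  assumes "general_position_set H S" "shortest_path H p"
    and "x \<in> S" "y \<in> S" "z \<in> S" "x \<in> set p" "y \<in> set p" "z \<in> set p"
    and "x \<noteq> y" "x \<noteq> z" "y \<noteq> z"
  shows False
proof -
  have "card {x, y, z} \<le> card (S \<inter> set p)"
    using assms by (intro card_mono) auto
  moreover have "card {x, y, z} = 3" using assms by simp
  ultimately show False using assms(1,2) unfolding general_position_set_def by auto
qed

section \<open>Neighbourhoods\<close>

definition neighbourhood :: "'a pair_pre_digraph \<Rightarrow> 'a \<Rightarrow> 'a set" where
  "neighbourhood G v = {w. (v, w) \<in> parcs G}"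

lemma in_neighbourhood: "w \<in> neighbourhood G v \<longleftrightarrow> (v, w) \<in> parcs G"
  by (simp add: neighbourhood_def)

lemma card_UN_le_mult:
  assumes "finite I" "\<And>i. i \<in> I \<Longrightarrow> card (F i) \<le> k"
  shows "card (\<Union>i\<in>I. F i) \<le> card I * k"
  using card_UN_le[OF assms(1), of F] sum_bounded_above[of I "\<lambda>i. card (F i)" k] assms(2)
  by fastforce

locale connected_regular_graph = pair_graph G for G :: "'a pair_pre_digraph" +
  fixes d :: nat
  assumes conn: "Digraph_Component.connected (with_proj G)"
    and reg: "regular d G"
begin

abbreviation V where "V \<equiv> pverts G"
abbreviation N where "N \<equiv> neighbourhood G"

lemma N_sym: "w \<in> N v \<Longrightarrow> v \<in> N w"
  by (simp add: in_neighbourhood arcs_symmetric)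

lemma N_irrefl: "v \<notin> N v"
  using pair_no_loops[of "(v, v)"] by (auto simp: in_neighbourhood)

lemma N_subset: "N v \<subseteq> V"
  by (auto simp: in_neighbourhood dest: in_arcsD2)

lemma N_vertex: "w \<in> N v \<Longrightarrow> v \<in> V"
  by (auto simp: in_neighbourhood dest: in_arcsD1)

lemma finite_N [simp, intro]: "finite (N v)"
  using N_subset pair_finite_verts by (rule finite_subset)

lemma card_N:
  assumes "v \<in> V"
  shows "card (N v) = d"
proof -
  have "card (N v) = card (snd ` {e \<in> parcs G. fst e = v})"
    by (rule arg_cong[where f = card]) (force simp: in_neighbourhood)
  also have "\<dots> = card {e \<in> parcs G. fst e = v}"
    by (rule card_image) (auto simp: inj_on_def)
  finally show ?thesis
    using reg assms by (simp add: regular_def out_degree_def out_arcs_def)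
qed

lemma nonempty: "V \<noteq> {}"
  using conn by (auto simp: connected_conv)

lemma closed_set_eq_verts:
  assumes "X \<subseteq> V" "X \<noteq> {}" and closed: "\<And>x. x \<in> X \<Longrightarrow> N x \<subseteq> X"
  shows "X = V"
proof -
  obtain x where x: "x \<in> X" using assms by auto
  have "y \<in> X" if "y \<in> V" for y
  proof -
    have "(x, y) \<in> rtrancl_on V ((parcs G)\<^sup>s)"
      using conn x that assms(1) by (auto simp: connected_conv)
    then show ?thesis
    proof (induction rule: rtrancl_on_induct)
      case base
      show ?case by fact
    next
      case (step y z)
      then have "z \<in> N y" by (auto simp: in_neighbourhood symcl_def arcs_symmetric)
      then show ?case using closed step by blast
    qed
  qed
  then show ?thesis using assms(1) by auto
qed

text \<open>
  Double counting: \<open>d |X|\<close> edges leave \<open>X\<close>, all of them end in \<open>Y\<close>, and \<open>Y\<close> has only \<open>d |Y|\<close> edge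
  ends to offer.
\<close>

lemma card_le_card_if_neighbourhoods_subset:
  assumes "X \<subseteq> V" "Y \<subseteq> V" "0 < d" and sub: "\<And>x. x \<in> X \<Longrightarrow> N x \<subseteq> Y"
  shows "card X \<le> card Y"
proof -
  have fin: "finite X" "finite Y" using assms pair_finite_verts by (auto intro: finite_subset)
  have edges: "card (SIGMA x:Z. N x) = card Z * d" if "Z \<subseteq> V" "finite Z" for Z
    using that card_N by (subst card_SigmaI) (auto simp: subset_iff)
  have "card (SIGMA x:X. N x) \<le> card (SIGMA y:Y. N y)"
    by (rule card_inj_on_le[where f = prod.swap]) (use fin sub N_sym in \<open>auto intro: subsetD[OF sub]\<close>)
  then show ?thesis using edges fin assms by simp
qed

end

section \<open>General position sets of the Mycielskian\<close>

lemma parcs_mycielskian [simp]: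
  "(Orig u, Orig v) \<in> parcs (mycielskian G) \<longleftrightarrow> v \<in> neighbourhood G u"
  "(Orig u, Twin v) \<in> parcs (mycielskian G) \<longleftrightarrow> v \<in> neighbourhood G u"
  "(Twin v, Orig u) \<in> parcs (mycielskian G) \<longleftrightarrow> v \<in> neighbourhood G u"
  "(Twin u, Twin v) \<notin> parcs (mycielskian G)"
  "(Orig u, Root) \<notin> parcs (mycielskian G)"
  "(Root, Orig u) \<notin> parcs (mycielskian G)"
  "(Root, Root) \<notin> parcs (mycielskian G)"
  "(Twin v, Root) \<in> parcs (mycielskian G) \<longleftrightarrow> v \<in> pverts G"
  "(Root, Twin v) \<in> parcs (mycielskian G) \<longleftrightarrow> v \<in> pverts G"
  by (auto simp: mycielskian_def in_neighbourhood)

locale mycielskian_general_position = connected_regular_graph G d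
  for G :: "'a pair_pre_digraph" and d +
  fixes S :: "'a mycielski_vertex set"
  assumes gp: "general_position_set (mycielskian G) S"
begin

lemma mycielskian_pair_graph: "pair_graph (mycielskian G)"
  by (rule pair_graph_mycielskian) unfold_locales

lemmas geodesic2 = shortest_path_two[OF mycielskian_pair_graph]
lemmas geodesic3 = shortest_path_three[OF mycielskian_pair_graph]
lemmas geodesic4 = shortest_path_four[OF mycielskian_pair_graph]
lemmas no_three = general_position_no_three_on_geodesic[OF gp]

definition origs where "origs = {v. Orig v \<in> S}"
definition twins where "twins = {v. Twin v \<in> S}"

lemma origs_subset: "origs \<subseteq> V" and twins_subset: "twins \<subseteq> V"
  using gp by (auto simp: origs_def twins_def general_position_set_def mycielskian_def)

text \<open>
  The following six constraints come from one geodesic each, which is written out in the proof. In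
  the last four, \<open>w\<close> is a neighbour of \<open>u\<close> such that \<open>u\<close> and the twin of \<open>w\<close> are in \<open>S\<close>; the geodesics
  run through this edge and continue either across the root or inside \<open>G\<close>. A walk in the Mycielskian
  that avoids the root projects to a walk of the same length in \<open>G\<close>, so only distances in \<open>G\<close> and
  walks across the root matter for shortness.
\<close>

lemma no_orig_neighbour_of_pair:
  assumes "u \<in> origs" "u \<in> twins" "w \<in> N u"
  shows "w \<notin> origs"
proof
  assume "w \<in> origs"
  have "shortest_path (mycielskian G) [Orig u, Orig w, Twin u]"
    using assms N_sym N_irrefl by (intro geodesic2) auto
  then show False
    by (rule no_three[where x = "Orig u" and y = "Orig w" and z = "Twin u"])
      (use assms \<open>w \<in> origs\<close> N_irrefl in \<open>auto simp: origs_def twins_def\<close>)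
qed

lemma twin_neighbour_unique:
  assumes "u \<in> origs" "w \<in> N u" "w \<in> twins" "x \<in> N u" "x \<in> twins"
  shows "w = x"
proof (rule ccontr)
  assume "w \<noteq> x"
  then have "shortest_path (mycielskian G) [Twin w, Orig u, Twin x]"
    using assms by (intro geodesic2) auto
  then show False
    by (rule no_three[where x = "Twin w" and y = "Orig u" and z = "Twin x"])
      (use assms \<open>w \<noteq> x\<close> in \<open>auto simp: origs_def twins_def\<close>)
qed

lemma twin_within_two:
  assumes "u \<in> origs" "w \<in> N u" "w \<in> twins" "v \<in> twins" "v \<noteq> u" "v \<notin> N u"
  shows "\<exists>z \<in> N u. v \<in> N z"
proof (rule ccontr)
  assume far: "\<not> ?thesis"
  have "shortest_path (mycielskian G) [Orig u, Twin w, Root, Twin v]"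
  proof (rule geodesic3)
    show "(x, Twin v) \<notin> parcs (mycielskian G)" if "(Orig u, x) \<in> parcs (mycielskian G)" for x
      using that far by (cases x) auto
  qed (use assms twins_subset in auto)
  then show False
    by (rule no_three[where x = "Orig u" and y = "Twin w" and z = "Twin v"])
      (use assms in \<open>auto simp: origs_def twins_def\<close>)
qed

lemma orig_within_three:
  assumes "u \<in> origs" "w \<in> N u" "w \<in> twins" "v \<in> origs"
    and "v \<noteq> u" "v \<notin> N u" "\<And>z. z \<in> N u \<Longrightarrow> v \<notin> N z" "d \<noteq> 0"
  shows "\<exists>y \<in> N u. \<exists>z \<in> N y. v \<in> N z"
proof (rule ccontr)
  assume far: "\<not> ?thesis"
  have "N v \<noteq> {}" using assms origs_subset card_N[of v] by auto
  then obtain x where x: "x \<in> N v" by auto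
  have "shortest_path (mycielskian G) [Orig u, Twin w, Root, Twin x, Orig v]"
  proof (rule geodesic4)
    show "(y, Orig v) \<notin> parcs (mycielskian G)" if "(Orig u, y) \<in> parcs (mycielskian G)" for y
      using that assms(7) N_sym by (cases y) auto
    show "(z, Orig v) \<notin> parcs (mycielskian G)"
      if "(Orig u, y) \<in> parcs (mycielskian G)" "(y, z) \<in> parcs (mycielskian G)" for y z
      using that far N_sym by (cases y; cases z; force)
  qed (use assms twins_subset N_subset x in auto)
  then show False
    by (rule no_three[where x = "Orig u" and y = "Twin w" and z = "Orig v"])
      (use assms in \<open>auto simp: origs_def twins_def\<close>)
qed

lemma third_orig_not_via_twin:
  assumes "u \<in> origs" "w \<in> N u" "w \<in> twins" "v \<in> origs"
    and "v \<noteq> u" "v \<notin> N u" "\<And>z. z \<in> N u \<Longrightarrow> v \<notin> N z" "x \<in> N w"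
  shows "v \<notin> N x"
proof
  assume "v \<in> N x"
  have "shortest_path (mycielskian G) [Orig u, Twin w, Orig x, Orig v]"
  proof (rule geodesic3)
    show "(y, Orig v) \<notin> parcs (mycielskian G)" if "(Orig u, y) \<in> parcs (mycielskian G)" for y
      using that assms(7) N_sym by (cases y) auto
  qed (use assms \<open>v \<in> N x\<close> N_sym in auto)
  then show False
    by (rule no_three[where x = "Orig u" and y = "Twin w" and z = "Orig v"])
      (use assms in \<open>auto simp: origs_def twins_def\<close>)
qed

lemma second_orig_within_two_of_twin:
  assumes "u \<in> origs" "w \<in> N u" "w \<in> twins" "y \<in> N u" "x \<in> N y" "x \<in> origs"
    and "x \<noteq> u" "x \<noteq> w" "x \<notin> N w"
  shows "\<exists>p \<in> N w. x \<in> N p"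
proof (rule ccontr)
  assume far: "\<not> ?thesis"
  have "shortest_path (mycielskian G) [Twin w, Orig u, Orig y, Orig x]"
  proof (rule geodesic3)
    show "(z, Orig x) \<notin> parcs (mycielskian G)" if "(Twin w, z) \<in> parcs (mycielskian G)" for z
      using that far assms N_sym by (cases z) auto
  qed (use assms N_sym in auto)
  then show False
    by (rule no_three[where x = "Twin w" and y = "Orig u" and z = "Orig x"])
      (use assms in \<open>auto simp: origs_def twins_def\<close>)
qed


definition pairs where "pairs = origs \<inter> twins"
definition missing where "missing = V - (origs \<union> twins)"

lemma finite_pairs: "finite pairs" and finite_missing: "finite missing"
  using pair_finite_verts origs_subset
  by (auto simp: pairs_def missing_def intro: finite_subset)

lemma neighbour_of_pair:
  assumes "u \<in> pairs" "w \<in> N u"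
  shows "w \<in> twins \<or> w \<in> missing"
  using assms no_orig_neighbour_of_pair N_subset by (auto simp: pairs_def missing_def)

text \<open>
  The places left for \<open>S\<close> around a pair \<open>u\<close>, apart from \<open>w\<close> and its neighbours: the ends of walks
  of length two and three from \<open>u\<close> that do not start through \<open>w\<close>. The walks of length three skip
  pairs, since no neighbour of a pair is in \<open>S\<close>. The sets are unions over the previous level, so
  that their sizes are bounded by counting branches.
\<close>

definition side_seconds where
  "side_seconds u w = (\<Union>y \<in> N u - {w}. N y - {u})"

definition side_thirds where
  "side_thirds u w = (\<Union>z \<in> side_seconds u w - pairs. N z - N u)"

lemma finite_side_seconds: "finite (side_seconds u w)"
  by (simp add: side_seconds_def)

lemma card_side_seconds_le:
  assumes "w \<in> N u"
  shows "card (side_seconds u w) \<le> (d - 1) * (d - 1)"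
proof -
  have "card (N y - {u}) \<le> d - 1" if "y \<in> N u - {w}" for y
    using that N_sym N_subset card_N[of y] by (subst card_Diff_singleton) auto
  then have "card (side_seconds u w) \<le> card (N u - {w}) * (d - 1)"
    unfolding side_seconds_def by (intro card_UN_le_mult) auto
  also have "card (N u - {w}) = d - 1"
    using assms card_N[of u] N_vertex by (subst card_Diff_singleton) auto
  finally show ?thesis .
qed

lemma card_side_thirds_le:
  "card (side_thirds u w) \<le> card (side_seconds u w - pairs) * (d - 1)"
  unfolding side_thirds_def
proof (rule card_UN_le_mult)
  fix z assume "z \<in> side_seconds u w - pairs"
  \<comment> \<open>Of the \<open>d\<close> edges at \<open>z\<close>, one leads back towards \<open>u\<close>.\<close>
  then obtain y where y: "y \<in> N u" "z \<in> N y" by (auto simp: side_seconds_def)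
  have "N z - N u \<subseteq> N z - {y}" using y by auto
  then have "card (N z - N u) \<le> card (N z - {y})" by (intro card_mono) auto
  also have "\<dots> = d - 1"
    using y N_sym N_subset card_N[of z] by (subst card_Diff_singleton) auto
  finally show "card (N z - N u) \<le> d - 1" .
qed (simp add: finite_side_seconds)

lemma twins_near_pair:
  assumes "u \<in> pairs" "w \<in> N u" "w \<in> twins"
  shows "twins \<subseteq> {w} \<union> N w \<union> side_seconds u w"
proof
  fix v assume v: "v \<in> twins"
  have u: "u \<in> origs" using assms by (simp add: pairs_def)
  consider "v = u" | "v \<in> N u" | z where "v \<noteq> u" "z \<in> N u" "v \<in> N z"
    using twin_within_two[OF u assms(2,3) v] by blast
  then show "v \<in> {w} \<union> N w \<union> side_seconds u w"
  proof cases
    case 1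
    then show ?thesis using assms(2) N_sym by auto
  next
    case 2
    then show ?thesis using twin_neighbour_unique[OF u assms(2,3) _ v] by auto
  next
    case 3
    then show ?thesis by (cases "z = w") (auto simp: side_seconds_def)
  qed
qed

lemma origs_near_pair:
  assumes "u \<in> pairs" "w \<in> N u" "w \<in> twins"
  shows "origs \<subseteq> N w \<union> side_seconds u w \<union> side_thirds u w"
proof
  fix v assume v: "v \<in> origs"
  have u: "u \<in> origs" "u \<in> twins" using assms by (auto simp: pairs_def)
  have "d \<noteq> 0" using assms(2) card_N[OF N_vertex[OF assms(2)]] card_gt_0_iff[of "N u"] by auto
  have "v \<notin> N u" using no_orig_neighbour_of_pair[OF u] v by blast
  then consider "v = u" | z where "v \<noteq> u" "z \<in> N u" "v \<in> N z"
    | "v \<noteq> u" "v \<notin> N u" "\<And>z. z \<in> N u \<Longrightarrow> v \<notin> N z"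
    by blast
  then show "v \<in> N w \<union> side_seconds u w \<union> side_thirds u w"
  proof cases
    case 1
    then show ?thesis using assms(2) N_sym by auto
  next
    case 2
    then show ?thesis by (cases "z = w") (auto simp: side_seconds_def)
  next
    case 3
    then obtain y z where yz: "y \<in> N u" "z \<in> N y" "v \<in> N z"
      using orig_within_three[OF u(1) assms(2,3) v] \<open>d \<noteq> 0\<close> by blast
    have "y \<noteq> w"
      using third_orig_not_via_twin[OF u(1) assms(2,3) v 3] yz by blast
    moreover have "z \<noteq> u" using yz 3 by blast
    ultimately have "z \<in> side_seconds u w" using yz by (auto simp: side_seconds_def)
    moreover have "z \<notin> pairs"
      using no_orig_neighbour_of_pair[of z v] v yz by (auto simp: pairs_def)
    ultimately show ?thesis using yz 3 by (auto simp: side_thirds_def)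
  qed
qed

text \<open>
  A pair \<open>u\<close> next to \<open>w\<close> has \<open>d - 1\<close> missing neighbours, while \<open>w\<close> has only \<open>d\<close> neighbours. More
  pairs than missing vertices are thus possible only with \<open>d\<close> pairs and \<open>d - 1\<close> missing vertices, and
  then every pair is adjacent to exactly \<open>w\<close> and the missing vertices. These \<open>2 d\<close> vertices form a
  component.
\<close>

lemma card_pairs_le_if_pairs_around_twin:
  assumes "0 < d" "2 * d < card V" "w \<in> twins" "w \<notin> origs" "pairs \<subseteq> N w" "u \<in> pairs"
  shows "card pairs \<le> card missing"
proof (rule ccontr)
  assume more: "\<not> ?thesis"
  have w: "w \<in> V" using assms twins_subset by auto
  have miss: "N a - {w} \<subseteq> missing" "w \<in> N a" "card (N a - {w}) = d - 1" if "a \<in> pairs" for a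
  proof -
    show wa: "w \<in> N a" using that assms N_sym by auto
    have "a \<in> origs" using that by (simp add: pairs_def)
    then show "N a - {w} \<subseteq> missing"
      using neighbour_of_pair[OF that] twin_neighbour_unique[OF _ wa \<open>w \<in> twins\<close>] by blast
    show "card (N a - {w}) = d - 1"
      using wa card_N[of a] N_vertex by (subst card_Diff_singleton) auto
  qed
  have "d - 1 \<le> card missing"
    using miss[OF \<open>u \<in> pairs\<close>] card_mono[OF finite_missing] by metis
  moreover have "card pairs \<le> d"
    using card_mono[OF finite_N \<open>pairs \<subseteq> N w\<close>] card_N w by simp
  ultimately have cards: "card pairs = d" "card missing = d - 1" using more by auto
  then have pairs_eq: "pairs = N w"
    using card_subset_eq[OF finite_N \<open>pairs \<subseteq> N w\<close>] card_N w by simp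
  have N_pair: "N a = insert w missing" if "a \<in> pairs" for a
    using card_subset_eq[OF finite_missing miss(1)[OF that]] miss(2,3)[OF that] cards by auto
  have N_missing: "N y = pairs" if "y \<in> missing" for y
  proof -
    have "pairs \<subseteq> N y" using N_pair that N_sym by blast
    moreover have "y \<in> V" using that by (simp add: missing_def)
    ultimately show ?thesis using card_subset_eq[OF finite_N, of pairs y] cards card_N by simp
  qed
  have "{w} \<union> pairs \<union> missing = V"
  proof (rule closed_set_eq_verts)
    show "{w} \<union> pairs \<union> missing \<subseteq> V"
      using w origs_subset by (auto simp: pairs_def missing_def)
    show "N x \<subseteq> {w} \<union> pairs \<union> missing" if "x \<in> {w} \<union> pairs \<union> missing" for x
      using that pairs_eq N_pair N_missing by blast
  qed simp
  then have "card V \<le> card {w} + card pairs + card missing"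
    by (metis card_Un_le add_le_mono1 le_trans)
  then show False using cards assms by simp
qed

text \<open>
  The core of the argument: the places for vertices that are not missing, counted around a pair \<open>u\<close>
  whose neighbour \<open>w\<close> has its twin in \<open>S\<close>. With \<open>near\<close> pairs next to \<open>w\<close> and \<open>far\<close> other pairs, there
  are at most \<open>2 + e + e\<^sup>2 + e (e\<^sup>2 - far)\<close> such places, and by assumption at most
  \<open>near + far - 1\<close> missing vertices. As \<open>near \<le> e\<close> and \<open>far \<ge> 1\<close>, the total is at most
  \<open>2 + e + e\<^sup>2 + e\<^sup>3 - (e - 1) (far - 1)\<close>.
\<close>

lemma card_pairs_le_card_missing:
  assumes d: "d = Suc e" "1 \<le> e" and order: "e ^ 3 + e ^ 2 + e + 3 \<le> card V"
  shows "card pairs \<le> card missing"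
proof (rule ccontr)
  assume more: "\<not> ?thesis"
  obtain u w where u: "u \<in> pairs" and w: "w \<in> N u" "w \<in> twins"
  proof (rule ccontr)
    assume "\<not> thesis"
    then have none: "\<And>u w. u \<in> pairs \<Longrightarrow> w \<in> N u \<Longrightarrow> w \<notin> twins"
      using that by blast
    have "N v \<subseteq> missing" if "v \<in> pairs" for v
      using none[OF that] neighbour_of_pair[OF that] by blast
    then have "card pairs \<le> card missing"
      using d origs_subset
      by (intro card_le_card_if_neighbourhoods_subset) (auto simp: pairs_def missing_def)
    then show False using more by simp
  qed
  have u': "u \<in> origs" "u \<in> twins" using u by (auto simp: pairs_def)
  have w_orig: "w \<notin> origs" using no_orig_neighbour_of_pair[OF u' w(1)] .
  have "w \<in> V" using w twins_subset by auto

  have pairs_near: "pairs \<subseteq> N w \<union> side_seconds u w"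
    using twins_near_pair[OF u w] w_orig by (auto simp: pairs_def)
  have far_pair: "\<not> pairs \<subseteq> N w"
  proof
    assume "pairs \<subseteq> N w"
    moreover have "2 * d < card V"
      using order d by (cases e) (auto simp: power2_eq_square power3_eq_cube)
    ultimately show False
      using card_pairs_le_if_pairs_around_twin[of w u] d w w_orig u more by simp
  qed
  \<comment> \<open>A pair \<open>x\<close> that is not a neighbour of \<open>w\<close> has a common neighbour \<open>p\<close> with \<open>w\<close>; being adjacent
    to a pair, \<open>p\<close> is not one. This improves the bound on \<open>near\<close> from \<open>d\<close> to \<open>e\<close>.\<close>
  then obtain x where x: "x \<in> pairs" "x \<notin> N w" by blast
  then have x': "x \<in> origs" "x \<in> twins" by (auto simp: pairs_def)
  have "x \<in> side_seconds u w" using pairs_near x by blast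
  then obtain y where y: "y \<in> N u" "x \<in> N y" "x \<noteq> u" by (auto simp: side_seconds_def)
  have "x \<noteq> w" using x' w_orig by auto
  then obtain p where p: "p \<in> N w" "x \<in> N p"
    using second_orig_within_two_of_twin[OF u'(1) w y(1,2) x'(1) y(3) _ x(2)] by blast
  have p_pair: "p \<notin> pairs"
    using no_orig_neighbour_of_pair[of p x] p x' by (auto simp: pairs_def)

  define near far where "near = card (pairs \<inter> N w)" and "far = card (pairs - N w)"
  have pairs_card: "card pairs = near + far"
    unfolding near_def far_def using card_Int_Diff[OF finite_pairs] .
  have "near \<le> card (N w - {p})"
    unfolding near_def using p_pair by (intro card_mono) auto
  then have near_le: "near \<le> e"
    using p \<open>w \<in> V\<close> card_N[of w] d by (simp add: card_Diff_singleton)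
  have far_pos: "1 \<le> far"
    unfolding far_def using x finite_pairs card_gt_0_iff[of "pairs - N w"] by auto

  define seconds where "seconds = card (side_seconds u w)"
  define open_seconds where "open_seconds = card (side_seconds u w - pairs)"
  have seconds_le: "seconds \<le> e * e"
    unfolding seconds_def using card_side_seconds_le[OF w(1)] d by simp
  have "far + open_seconds = card ((pairs - N w) \<union> (side_seconds u w - pairs))"
    unfolding far_def open_seconds_def
    using finite_pairs finite_side_seconds by (subst card_Un_disjoint) auto
  also have "\<dots> \<le> seconds"
    unfolding seconds_def using pairs_near finite_side_seconds by (intro card_mono) auto
  finally have open_le: "far + open_seconds \<le> seconds" .

  have "V \<subseteq> {w} \<union> N w \<union> side_seconds u w \<union> side_thirds u w \<union> missing"
    using twins_near_pair[OF u w] origs_near_pair[OF u w] by (auto simp: missing_def)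
  moreover have "finite (side_thirds u w)"
    by (simp add: side_thirds_def finite_side_seconds)
  ultimately have "card V \<le> card ({w} \<union> N w \<union> side_seconds u w \<union> side_thirds u w \<union> missing)"
    using finite_side_seconds finite_missing by (intro card_mono) auto
  also have "\<dots> \<le> card {w} + card (N w) + card (side_seconds u w) + card (side_thirds u w) + card missing"
    by (intro card_Un_le[THEN order_trans] add_mono order_refl)
  also have "\<dots> \<le> 1 + Suc e + seconds + open_seconds * e + (near + far - 1)"
    using card_side_thirds_le[of u w] card_N[OF \<open>w \<in> V\<close>] more pairs_card d
    by (simp add: seconds_def open_seconds_def)
  finally have total: "card V \<le> 1 + Suc e + seconds + open_seconds * e + (near + far - 1)" .
  have "int open_seconds * int e \<le> (int e * int e - int far) * int e"
    using open_le seconds_le by (intro mult_right_mono) (simp_all flip: of_nat_mult)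
  moreover have "0 \<le> (int e - 1) * (int far - 1)"
    using far_pos d by (intro mult_nonneg_nonneg) auto
  ultimately have "2 + int e + int seconds + int open_seconds * int e + (int near + int far - 1)
      \<le> int e ^ 3 + int e ^ 2 + int e + 2"
    using near_le seconds_le
    by (simp add: algebra_simps power2_eq_square power3_eq_cube flip: of_nat_mult)
  moreover have "int (card V) \<le> 2 + int e + int seconds + int open_seconds * int e + (int near + int far - 1)"
    using total far_pos by (simp flip: of_nat_mult of_nat_add)
  ultimately have "int (card V) \<le> int (e ^ 3 + e ^ 2 + e + 2)" by simp
  then show False using order by linarith
qed

lemma card_general_position:
  "card S = (if Root \<in> S then 1 else 0) + card origs + card twins"
proof -
  have fin: "finite origs" "finite twins"
    using origs_subset twins_subset pair_finite_verts finite_subset by blast+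
  have "S = (if Root \<in> S then {Root} else {}) \<union> (Orig ` origs \<union> Twin ` twins)"
  proof (rule set_eqI)
    show "x \<in> S \<longleftrightarrow> x \<in> (if Root \<in> S then {Root} else {}) \<union> (Orig ` origs \<union> Twin ` twins)" for x
      by (cases x) (auto simp: origs_def twins_def)
  qed
  then have "card S = card ((if Root \<in> S then {Root} else {}) \<union> (Orig ` origs \<union> Twin ` twins))"
    by (rule arg_cong)
  also have "\<dots> = (if Root \<in> S then 1 else 0) + card (Orig ` origs \<union> Twin ` twins)"
    using fin by (auto simp: card_insert_if)
  also have "card (Orig ` origs \<union> Twin ` twins) = card (Orig ` origs) + card (Twin ` twins)"
    using fin by (intro card_Un_disjoint) auto
  also have "\<dots> = card origs + card twins" by (simp add: card_image inj_on_def)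
  finally show ?thesis by simp
qed

text \<open>
  Without twins, it is enough that some vertex of \<open>G\<close> is not in \<open>S\<close>, and this holds as \<open>G\<close> has an
  induced path of length two: a closed neighbourhood has only \<open>d + 1\<close> vertices and hence is not
  closed under taking neighbours. Otherwise the root
  blocks a second twin, and the one twin in \<open>S\<close> blocks all neighbours of its vertex.
\<close>

lemma card_le_order_if_root:
  assumes "Root \<in> S" "2 \<le> d" "d + 2 \<le> card V"
  shows "card S \<le> card V"
proof (cases "twins = {}")
  case True
  obtain a where a: "a \<in> V" using nonempty by auto
  have "card (insert a (N a)) < card V"
    using a card_N assms(3) by (simp add: card_insert_if)
  then have "insert a (N a) \<noteq> V" by auto
  then obtain b c where bc: "b \<in> insert a (N a)" "c \<in> N b" "c \<notin> insert a (N a)"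
    using closed_set_eq_verts[of "insert a (N a)"] a N_subset by blast
  have "origs \<noteq> V"
  proof
    assume "origs = V"
    have "shortest_path (mycielskian G) [Orig a, Orig b, Orig c]"
      using bc by (intro geodesic2) auto
    then show False
      by (rule no_three[where x = "Orig a" and y = "Orig b" and z = "Orig c"])
        (use bc a N_subset \<open>origs = V\<close> N_irrefl in \<open>auto simp: origs_def\<close>)
  qed
  then have "card origs < card V"
    using origs_subset pair_finite_verts by (intro psubset_card_mono) auto
  then show ?thesis using True assms by (simp add: card_general_position)
next
  case False
  then obtain w where w: "w \<in> twins" by auto
  have "v = w" if "v \<in> twins" for v
  proof (rule ccontr)
    assume "v \<noteq> w"
    have "shortest_path (mycielskian G) [Twin v, Root, Twin w]"
      using w that twins_subset \<open>v \<noteq> w\<close> by (intro geodesic2) auto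
    then show False
      by (rule no_three[where x = "Twin v" and y = Root and z = "Twin w"])
        (use w that \<open>v \<noteq> w\<close> assms in \<open>auto simp: twins_def\<close>)
  qed
  then have "twins = {w}" using w by blast
  moreover have "v \<notin> origs" if "v \<in> N w" for v
  proof
    assume "v \<in> origs"
    have "shortest_path (mycielskian G) [Orig v, Twin w, Root]"
      using w N_sym[OF that] twins_subset by (intro geodesic2) auto
    then show False
      by (rule no_three[where x = "Orig v" and y = "Twin w" and z = Root])
        (use w \<open>v \<in> origs\<close> assms in \<open>auto simp: twins_def origs_def\<close>)
  qed
  then have "card origs \<le> card (V - N w)"
    using origs_subset pair_finite_verts by (intro card_mono) auto
  moreover have "card (V - N w) = card V - d"
    using card_Diff_subset[OF finite_N N_subset] card_N w twins_subset by auto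
  ultimately show ?thesis using assms by (simp add: card_general_position)
qed

lemma card_le_order:
  assumes "d = Suc e" "1 \<le> e" "e ^ 3 + e ^ 2 + e + 3 \<le> card V"
  shows "card S \<le> card V"
proof (cases "Root \<in> S")
  case True
  then show ?thesis using assms by (intro card_le_order_if_root) auto
next
  case False
  have fin: "finite origs" "finite twins"
    using origs_subset twins_subset pair_finite_verts finite_subset by blast+
  have "card S = card (origs \<union> twins) + card pairs"
    using False fin card_Un_Int by (simp add: card_general_position pairs_def)
  also have "\<dots> \<le> card (origs \<union> twins) + card missing"
    using card_pairs_le_card_missing[OF assms] by simp
  also have "\<dots> = card (origs \<union> twins \<union> missing)"
    using fin finite_missing by (subst card_Un_disjoint) (auto simp: missing_def)
  also have "origs \<union> twins \<union> missing = V"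
    using origs_subset twins_subset by (auto simp: missing_def)
  finally show ?thesis .
qed

end

section \<open>Meagre regular graphs\<close>

lemma set_vwalk_arcs_split:
  "set (vwalk_arcs (xs @ a # ys)) = set (vwalk_arcs (xs @ [a])) \<union> set (vwalk_arcs (a # ys))"
proof (induction xs)
  case (Cons x xs)
  then show ?case by (cases xs) auto
qed simp

text \<open>
  Between the first and the last twin on a shortest path there is at most one vertex, as the detour
  through the root has length two. Since twins are pairwise nonadjacent, that vertex is no twin.
\<close>

lemma general_position_twins:
  assumes "pair_graph G"
  shows "general_position_set (mycielskian G) (Twin ` pverts G)"
  unfolding general_position_set_def
proof (intro conjI allI impI notI)
  show "Twin ` pverts G \<subseteq> pverts (mycielskian G)" by (auto simp: mycielskian_def)
next
  let ?T = "Twin ` pverts G"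
  fix p assume p: "shortest_path (mycielskian G) p" and three: "3 \<le> card (?T \<inter> set p)"
  have walk: "vwalk p (with_proj (mycielskian G))" and "distinct p"
    using p by (auto simp: shortest_path_def vpath_def)
  have "?T \<inter> set p \<noteq> {}" using three by auto
  then have "\<exists>x \<in> set p. x \<in> ?T" by auto
  then obtain xs a rest where a: "p = xs @ a # rest" "a \<in> ?T" "\<forall>x \<in> set xs. x \<notin> ?T"
    by (rule split_list_first_propE)
  have "\<not> ?T \<inter> set p \<subseteq> {a}"
    using three card_mono[of "{a}" "?T \<inter> set p"] by auto
  then have "\<exists>x \<in> set rest. x \<in> ?T" using a by auto
  then obtain ys b zs where b: "rest = ys @ b # zs" "b \<in> ?T" "\<forall>x \<in> set zs. x \<notin> ?T"
    by (rule split_list_last_propE)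
  have p_eq: "p = xs @ a # ys @ b # zs" using a b by simp
  let ?q = "xs @ a # Root # b # zs"
  have "set (vwalk_arcs p) = set (vwalk_arcs (xs @ [a])) \<union>
      (set (vwalk_arcs ((a # ys) @ [b])) \<union> set (vwalk_arcs (b # zs)))"
    unfolding p_eq set_vwalk_arcs_split[of xs a "ys @ b # zs"]
    using set_vwalk_arcs_split[of "a # ys" b zs] by simp
  moreover have "set (vwalk_arcs ?q) = set (vwalk_arcs (xs @ [a])) \<union>
      ({(a, Root), (Root, b)} \<union> set (vwalk_arcs (b # zs)))"
    unfolding set_vwalk_arcs_split[of xs a "Root # b # zs"] by simp
  moreover have "(a, Root) \<in> parcs (mycielskian G)" "(Root, b) \<in> parcs (mycielskian G)"
    "Root \<in> pverts (mycielskian G)"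
    using a(2) b(2) by (auto simp: mycielskian_def)
  ultimately have "vwalk ?q (with_proj (mycielskian G))"
    using walk unfolding vwalk_def by (auto simp: p_eq)
  moreover have "hd ?q = hd p" "last ?q = last p" by (cases xs; simp add: p_eq)+
  ultimately have "length p \<le> length ?q" by (rule shortest_path_le_vwalk[OF p])
  then have "length ys \<le> 1" by (simp add: p_eq)
  then consider "ys = []" | c where "ys = [c]" by (cases ys) auto
  then have "?T \<inter> set p \<subseteq> {a, b}"
  proof cases
    case 1
    then show ?thesis using a(3) b(3) by (auto simp: p_eq)
  next
    case 2
    then have "(a, c) \<in> parcs (mycielskian G)"
      using walk \<open>set (vwalk_arcs p) = _\<close> unfolding vwalk_def by auto
    then have "c \<notin> ?T" using a(2) by auto
    then show ?thesis using a(3) b(3) 2 by (auto simp: p_eq)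
  qed
  then have "card (?T \<inter> set p) \<le> card {a, b}" by (intro card_mono) auto
  also have "\<dots> \<le> 2" by (simp add: card_insert_if)
  finally show False using three by simp
qed

context connected_regular_graph
begin

lemma two_mult_card_independent_le:
  assumes "independent_set G I" "0 < d"
  shows "2 * card I \<le> card V"
proof -
  have I: "I \<subseteq> V" using assms(1) by (simp add: independent_set_def)
  have "card I \<le> card (V - I)"
    using assms I N_subset
    by (intro card_le_card_if_neighbourhoods_subset)
      (auto simp: independent_set_def in_neighbourhood subset_iff)
  also have "\<dots> = card V - card I"
    using I pair_finite_verts by (meson card_Diff_subset finite_subset)
  finally show ?thesis
    using card_mono[OF pair_finite_verts I] by simp
qed

lemma two_mult_ip_le:
  assumes "0 < d"
  shows "2 * ip k G \<le> card V"
proof -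
  let ?C = "{card I | I. independent_position_set k G I}"
  have "?C \<subseteq> card ` Pow V"
    by (auto simp: independent_position_set_def independent_set_def)
  then have "finite ?C" using pair_finite_verts finite_subset by blast
  moreover have "independent_position_set k G {}"
    by (simp add: independent_position_set_def independent_set_def)
  then have "?C \<noteq> {}" by blast
  ultimately have "ip k G \<in> ?C" unfolding ip_def by (rule Max_in)
  then show ?thesis
    using two_mult_card_independent_le assms by (auto simp: independent_position_set_def)
qed

lemma gp_mycielskian_eq_order:
  assumes "d = Suc e" "1 \<le> e" "e ^ 3 + e ^ 2 + e + 3 \<le> card V"
  shows "gp (mycielskian G) = card V"
  unfolding gp_def
proof (rule Max_eqI)
  let ?C = "{card S | S. general_position_set (mycielskian G) S}"
  show le: "k \<le> card V" if "k \<in> ?C" for k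
  proof -
    obtain S where S: "k = card S" "general_position_set (mycielskian G) S"
      using \<open>k \<in> ?C\<close> by blast
    then interpret mycielskian_general_position G d S by unfold_locales
    show ?thesis using card_le_order[OF assms] S by simp
  qed
  show "finite ?C" using le by (intro finite_subset[of ?C "{..card V}"]) auto
  have "pair_graph G" by unfold_locales
  then have "general_position_set (mycielskian G) (Twin ` V)" by (rule general_position_twins)
  moreover have "card (Twin ` V) = card V" by (simp add: card_image inj_on_def)
  ultimately show "card V \<in> ?C" by (metis (mono_tags, lifting) mem_Collect_eq)
qed

text \<open>
  A vertex of degree at most one in a regular connected graph forms a component together with its
  neighbour, if any.
\<close>

lemma two_le_degree:
  assumes "d + 2 \<le> card V"
  shows "2 \<le> d"
proof (rule ccontr)
  assume "\<not> 2 \<le> d"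
  obtain v where v: "v \<in> V" using nonempty by auto
  have "insert v (N v) = V"
  proof (rule closed_set_eq_verts)
    show "N x \<subseteq> insert v (N v)" if "x \<in> insert v (N v)" for x
    proof (cases "x = v")
      case False
      then have x: "x \<in> N v" "v \<in> N x" using that N_sym by auto
      have "card (N x) \<le> 1" using \<open>\<not> 2 \<le> d\<close> card_N[OF N_vertex[OF x(2)]] by simp
      then have "N x \<subseteq> {v}"
        using x(2) card_le_Suc0_iff_eq[OF finite_N, of x] by auto
      then show ?thesis by blast
    qed auto
  qed (use v N_subset in auto)
  then have "card V = Suc d"
    using card_N[OF v] N_irrefl by (metis card_insert_disjoint finite_N)
  then show False using \<open>\<not> 2 \<le> d\<close> assms by auto
qed

lemma not_complete:
  assumes "d + 2 \<le> card V"
  shows "\<not> complete_digraph k (with_proj G)"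
proof
  assume "complete_digraph k (with_proj G)"
  then have E: "parcs G = {(u, v). (u, v) \<in> V \<times> V \<and> u \<noteq> v}"
    by (simp add: complete_digraph_pair_def)
  obtain v where v: "v \<in> V" using nonempty by auto
  have "N v = V - {v}" using v by (auto simp: neighbourhood_def E)
  then have "d = card V - 1" using card_N[OF v] v pair_finite_verts by simp
  then show False using assms by simp
qed

end

theorem theorem25:
  fixes G :: "'a pair_pre_digraph" and d :: nat
  assumes "pair_graph G"
    and "Digraph_Component.connected G"
    and "regular d G"
    and "int (card (pverts G)) \<ge> int d ^ 3 - 2 * int d ^ 2 + 2 * int d + 2"
  shows "meagre G"
proof -
  interpret pair_graph G by fact
  interpret connected_regular_graph G d using assms by unfold_locales auto
  have "2 \<le> d"
  proof (cases "d \<le> 1")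
    case True
    then have "d = 0 \<or> d = 1" by auto
    then show ?thesis using assms(4) by (intro two_le_degree) auto
  qed simp
  \<comment> \<open>In terms of \<open>e\<close>, the bound on the order is \<open>e\<^sup>3 + e\<^sup>2 + e + 3\<close>.\<close>
  define e where "e = d - 1"
  have d: "d = Suc e" "1 \<le> e" using \<open>2 \<le> d\<close> by (auto simp: e_def)
  have "int (e ^ 3 + e ^ 2 + e + 3) \<le> int (card (pverts G))"
    using assms(4) by (simp add: d algebra_simps power2_eq_square power3_eq_cube)
  then have order: "e ^ 3 + e ^ 2 + e + 3 \<le> card (pverts G)" by linarith
  then have "d + 2 \<le> card (pverts G)" using d by simp
  moreover have "max (card (pverts G)) (2 * ip 4 G) = card (pverts G)"
    using two_mult_ip_le[of 4] d by simp
  ultimately show ?thesis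
    unfolding meagre_def
    using assms(1,2) not_complete gp_mycielskian_eq_order[OF d order] \<open>2 \<le> d\<close> by auto
qed

end
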